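(* Let $Q(a,b,c,d)$ be an ideal hyperbolic quadrilateral in the unit disk $\mathbb{B}^2$. Let $d_1=d_\rho(J^*[a,d],J^*[b,c])$ and $d_2=d_\rho(J^*[a,b],J^*[c,d])$. Then $$d_1d_2\le\left(2\log(\sqrt2+1)\right)^2$$ and $$d_1+d_2\ge4\log(\sqrt2+1).$$ In both cases equality holds if and only if $|a,b,c,d|=2$.
   Context: $\mathbb{B}^2$ is the open unit disk in the plane with the hyperbolic metric $\rho$ of weight $2/(1-|x|^2)$, i.e. $\tanh\frac{\rho(x,y)}{2}=\frac{|x-y|}{\sqrt{|x-y|^2+(1-|x|^2)(1-|y|^2)}}$. Hyperbolic geodesic lines are the sets $C\cap\mathbb{B}^2$ where $C$ is a circle perpendicular to the unit circle or a Euclidean line through $0$. For distinct $a,b\in\partial\mathbb{B}^2$, $J^*[a,b]$ is the hyperbolic geodesic line with end points $a,b$. For nonempty $A,B\subset\mathbb{B}^2$, $d_\rho(A,B)=\inf_{x\in A,\,y\in B}\rho(x,y)$. An ideal hyperbolic quadrilateral $Q(a,b,c,d)$ is the domain in $\mathbb{B}^2$ bounded by the geodesic lines $J^*[a,b],J^*[b,c],J^*[c,d],J^*[d,a]$, where $a,b,c,d$ are four distinct points of the unit circle in positive order (all angles are zero). The absolute ratio is $|a,b,c,d|=\frac{|a-c||b-d|}{|a-b||c-d|}$. *)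

theory Defs
  imports "HOL-Analysis.Analysis"
begin

text \<open>The unit disk is \<^term>\<open>ball 0 1 :: complex set\<close>.\<close>

definition hyp_dist :: "complex \<Rightarrow> complex \<Rightarrow> real" where
  "hyp_dist x y = 2 * artanh (cmod (x - y) /
     sqrt ((cmod (x - y))\<^sup>2 + (1 - (cmod x)\<^sup>2) * (1 - (cmod y)\<^sup>2)))"

lemma tanh_half_hyp_dist:
  assumes "x \<in> ball 0 1" "y \<in> ball 0 1"
  shows "tanh (hyp_dist x y / 2) = cmod (x - y) /
     sqrt ((cmod (x - y))\<^sup>2 + (1 - (cmod x)\<^sup>2) * (1 - (cmod y)\<^sup>2))"
proof -
  define s where "s = (1 - (cmod x)\<^sup>2) * (1 - (cmod y)\<^sup>2)"
  have s: "s > 0"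
    using assms by (simp add: s_def abs_square_less_1)
  have "cmod (x - y) < sqrt ((cmod (x - y))\<^sup>2 + s)"
    using s by (intro real_less_rsqrt) simp
  moreover have "0 < sqrt ((cmod (x - y))\<^sup>2 + s)"
    using s by (simp add: add_nonneg_pos)
  ultimately have "\<bar>cmod (x - y) / sqrt ((cmod (x - y))\<^sup>2 + s)\<bar> < 1"
    by (simp add: divide_simps)
  moreover have "tanh (artanh t) = t" if "\<bar>t\<bar> < 1" for t :: real
  proof -
    have e: "exp (- 2 * artanh t) = (1 - t) / (1 + t)"
      using that by (simp add: artanh_def exp_minus abs_less_iff)
    show ?thesis
      unfolding tanh_real_altdef e using that by (simp add: field_simps abs_less_iff)
  qed
  ultimately show ?thesis
    by (simp add: hyp_dist_def s_def)
qed

text \<open>Circles meet perpendicularly when their radii to each common point are orthogonal;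
  the unit circle has centre \<open>0\<close>, so its radius to \<open>z\<close> is \<open>z\<close> itself.\<close>

definition perp_unit_circle :: "complex \<Rightarrow> real \<Rightarrow> bool" where
  "perp_unit_circle p r \<longleftrightarrow> r > 0 \<and> sphere p r \<inter> sphere 0 1 \<noteq> {} \<and>
     (\<forall>z \<in> sphere p r \<inter> sphere 0 1. orthogonal (z - p) z)"

definition hyp_line :: "complex set \<Rightarrow> bool" where
  "hyp_line L \<longleftrightarrow> (\<exists>C. L = C \<inter> ball 0 1 \<and>
     ((\<exists>p r. perp_unit_circle p r \<and> C = sphere p r) \<or> (\<exists>u. u \<noteq> 0 \<and> C = span {u})))"

text \<open>The end points of a line are the points of the unit circle in its closure. For distinct
  \<open>a\<close>, \<open>b\<close> on the unit circle there is exactly one line with end points \<open>a\<close>, \<open>b\<close>; for other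
  arguments \<open>geodesic_J\<close> is unspecified.\<close>

definition hyp_endpoints :: "complex set \<Rightarrow> complex set" where
  "hyp_endpoints L = closure L \<inter> sphere 0 1"

definition geodesic_J :: "complex \<Rightarrow> complex \<Rightarrow> complex set" where
  "geodesic_J a b = (THE L. hyp_line L \<and> hyp_endpoints L = {a, b})"

definition hyp_setdist :: "complex set \<Rightarrow> complex set \<Rightarrow> real" where
  "hyp_setdist A B = Inf {hyp_dist x y | x y. x \<in> A \<and> y \<in> B}"

text \<open>An ideal quadrilateral is determined by its vertices: four distinct points of the unit
  circle, met in the order \<open>a, b, c, d\<close> in one counterclockwise turn starting at \<open>a\<close>.\<close>

definition ideal_quadrilateral :: "complex \<Rightarrow> complex \<Rightarrow> complex \<Rightarrow> complex \<Rightarrow> bool" where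
  "ideal_quadrilateral a b c d \<longleftrightarrow> (\<exists>\<alpha> \<beta> \<gamma> \<delta>.
     a = cis \<alpha> \<and> b = cis \<beta> \<and> c = cis \<gamma> \<and> d = cis \<delta> \<and>
     \<alpha> < \<beta> \<and> \<beta> < \<gamma> \<and> \<gamma> < \<delta> \<and> \<delta> < \<alpha> + 2 * pi)"

definition absolute_ratio :: "complex \<Rightarrow> complex \<Rightarrow> complex \<Rightarrow> complex \<Rightarrow> real" where
  "absolute_ratio a b c d = (cmod (a - c) * cmod (b - d)) / (cmod (a - b) * cmod (c - d))"

end

theory Submission
  imports Defs
begin

text \<open>In the hyperboloid model the geodesic with end points \<open>a\<close>, \<open>b\<close> consists of the points
  \<open>(s (1, a) + (1, b) / s) / \<bar>a - b\<bar>\<close>, \<open>s > 0\<close>. Hence \<open>cosh \<rho>\<close> between points with parameters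
  \<open>s\<close>, \<open>u\<close> of \<open>J\<^sup>*[a,b]\<close>, \<open>J\<^sup>*[c,d]\<close> is a sum of two expressions, one in \<open>s u\<close> and one in \<open>s / u\<close>,
  and AM-GM minimises both at once:
  \<open>cosh d\<^sub>\<rho> = (\<bar>a-c\<bar> \<bar>b-d\<bar> + \<bar>a-d\<bar> \<bar>b-c\<bar>) / (\<bar>a-b\<bar> \<bar>c-d\<bar>)\<close>. With Ptolemy's theorem this gives
  \<open>sinh (d\<^sub>1 / 2) = v\<close> and \<open>sinh (d\<^sub>2 / 2) = 1 / v\<close>, where \<open>v = 1\<close> iff the absolute ratio is \<open>2\<close>.
  The sum is estimated by the addition theorem for \<open>cosh\<close>, the product by its derivative in \<open>v\<close>.\<close>

subsection \<open>The area hyperbolic sine at reciprocal arguments\<close>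

lemma arsinh_le_self:
  fixes x :: real assumes "x \<ge> 0" shows "arsinh x \<le> x"
proof -
  have "arsinh x - x \<le> arsinh 0 - 0"
  proof (rule DERIV_nonpos_imp_nonincreasing[OF assms])
    fix t :: real
    have "((\<lambda>x. arsinh x - x) has_real_derivative (1 / sqrt (t\<^sup>2 + 1) - 1)) (at t)"
      by (auto intro!: derivative_eq_intros)
    moreover have "1 / sqrt (t\<^sup>2 + 1) - 1 \<le> 0"
      using zero_le_power2[of t] by (simp add: add_nonneg_pos)
    ultimately show "\<exists>y. ((\<lambda>x. arsinh x - x) has_real_derivative y) (at t) \<and> y \<le> 0" by blast
  qed
  then show ?thesis by simp
qed

lemma has_real_derivative_arsinh_inverse:
  fixes t :: real assumes "t > 0"
  shows "((\<lambda>v. arsinh (1 / v)) has_real_derivative - 1 / (t * sqrt (t\<^sup>2 + 1))) (at t)"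
proof -
  have r: "sqrt ((1 / t)\<^sup>2 + 1) = sqrt (t\<^sup>2 + 1) / t"
    using assms by (intro real_sqrt_unique) (auto simp: field_simps power2_eq_square)
  have "((\<lambda>v. arsinh (1 / v)) has_real_derivative 1 / sqrt ((1 / t)\<^sup>2 + 1) * (- 1 / t\<^sup>2)) (at t)"
    using assms
    by (intro DERIV_chain2[OF arsinh_real_has_field_derivative])
       (auto intro!: derivative_eq_intros simp: power2_eq_square)
  also have "1 / sqrt ((1 / t)\<^sup>2 + 1) * (- 1 / t\<^sup>2) = - 1 / (t * sqrt (t\<^sup>2 + 1))"
    unfolding r using assms by (simp add: power2_eq_square)
  finally show ?thesis .
qed

text \<open>This decides the sign of the derivative of \<open>arsinh v * arsinh (1 / v)\<close>. The
  difference of the two sides vanishes at \<open>1\<close> and increases, because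
  \<open>arsinh (1 / t)\<close> is at most \<open>1 / t\<close>, which is below
  \<open>2 / sqrt (t\<^sup>2 + 1)\<close>.\<close>

lemma arsinh_gt_mult_arsinh_inverse:
  fixes v :: real assumes "v > 1" shows "v * arsinh (1 / v) < arsinh v"
proof -
  have "arsinh 1 - 1 * arsinh (1 / 1) < arsinh v - v * arsinh (1 / v)"
  proof (rule DERIV_pos_imp_increasing[OF assms])
    fix t :: real assume t: "1 \<le> t"
    have 1: "((\<lambda>v. arsinh v - v * arsinh (1 / v)) has_real_derivative
        2 / sqrt (t\<^sup>2 + 1) - arsinh (1 / t)) (at t)"
      using t by (auto intro!: derivative_eq_intros has_real_derivative_arsinh_inverse)
    have "t\<^sup>2 + 1 < 4 * t\<^sup>2"
      using one_le_power[OF t, of 2] by linarith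
    also have "\<dots> = (2 * t)\<^sup>2" by simp
    finally have "sqrt (t\<^sup>2 + 1) < 2 * t"
      using t by (intro real_less_lsqrt) auto
    then have "1 / t < 2 / sqrt (t\<^sup>2 + 1)"
      using t by (simp add: divide_less_eq less_divide_eq field_simps add_pos_nonneg)
    moreover have "arsinh (1 / t) \<le> 1 / t" using t by (intro arsinh_le_self) auto
    ultimately show "\<exists>y. ((\<lambda>v. arsinh v - v * arsinh (1 / v)) has_real_derivative y) (at t) \<and> 0 < y"
      using 1 by (intro exI[of _ "2 / sqrt (t\<^sup>2 + 1) - arsinh (1 / t)"]) simp
  qed
  then show ?thesis by simp
qed

text \<open>The product is unchanged when \<open>v\<close> is replaced by \<open>1 / v\<close>,
  which reduces to \<open>v > 1\<close>; there the preceding inequality makes the derivative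
  negative.\<close>

lemma arsinh_mult_arsinh_inverse_less:
  fixes v :: real assumes "v > 0" "v \<noteq> 1" shows "arsinh v * arsinh (1 / v) < (arsinh 1)\<^sup>2"
proof -
  have gt: "arsinh v * arsinh (1 / v) < (arsinh 1)\<^sup>2" if "v > 1" for v :: real
  proof -
    have "arsinh v * arsinh (1 / v) < arsinh 1 * arsinh (1 / 1)"
    \<comment> \<open>The derivative vanishes at \<open>1\<close>, so strict decrease comes from its
      sign on the open interval and continuity on the closed one.\<close>
    proof (rule DERIV_neg_imp_decreasing_open[OF that])
      fix t :: real assume t: "1 < t"
      have 1: "((\<lambda>v. arsinh v * arsinh (1 / v)) has_real_derivative
          (t * arsinh (1 / t) - arsinh t) / (t * sqrt (t\<^sup>2 + 1))) (at t)"
        using t by (auto intro!: derivative_eq_intros has_real_derivative_arsinh_inverse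
            simp: diff_divide_distrib)
      have "(t * arsinh (1 / t) - arsinh t) / (t * sqrt (t\<^sup>2 + 1)) < 0"
        using t arsinh_gt_mult_arsinh_inverse[OF t]
        by (intro divide_neg_pos) (auto intro!: mult_pos_pos add_nonneg_pos)
      with 1 show "\<exists>y. ((\<lambda>v. arsinh v * arsinh (1 / v)) has_real_derivative y) (at t) \<and> y < 0"
        by blast
    next
      show "continuous_on {1..v} (\<lambda>v. arsinh v * arsinh (1 / v))"
        by (auto intro!: continuous_intros)
    qed
    then show ?thesis by (simp add: power2_eq_square)
  qed
  show ?thesis
  proof (cases "v > 1")
    case True then show ?thesis by (rule gt)
  next
    case False
    then have "1 / v > 1" using assms by simp
    from gt[OF this] show ?thesis by (simp add: mult.commute)
  qed
qed

text \<open>\<open>cosh\<close> of the right-hand side is \<open>v + 1 / v + 1\<close>, which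
  exceeds \<open>3\<close> because \<open>(v - 1)\<^sup>2 > 0\<close>; and
  \<open>cosh (arsinh 1) = sqrt 2\<close> gives
  \<open>cosh (2 * arsinh 1) = 2 * 2 - 1\<close>.\<close>

lemma arsinh_add_arsinh_inverse_gt:
  fixes v :: real assumes "v > 0" "v \<noteq> 1" shows "2 * arsinh 1 < arsinh v + arsinh (1 / v)"
proof -
  have "sqrt ((1 / v)\<^sup>2 + 1) = sqrt (v\<^sup>2 + 1) / v"
    using assms by (intro real_sqrt_unique) (auto simp: field_simps power2_eq_square)
  then have "cosh (arsinh v + arsinh (1 / v)) = (v\<^sup>2 + 1) / v + 1"
    using assms by (simp add: cosh_add cosh_arsinh_real)
  also have "\<dots> > 3"
  proof -
    have "0 < (v - 1)\<^sup>2" using assms by simp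
    then show ?thesis using assms by (simp add: field_simps power2_eq_square)
  qed
  also have "3 = cosh (2 * arsinh (1::real))"
    by (simp add: cosh_double_cosh cosh_arsinh_real)
  finally show ?thesis
    using assms by (subst (asm) cosh_real_nonneg_less_iff) (auto intro!: add_nonneg_nonneg simp: less_imp_le)
qed

subsection \<open>Geodesics of the unit disk\<close>

text \<open>If \<open>tanh r = n / sqrt (n\<^sup>2 + s)\<close>, then
  \<open>sinh r = n / sqrt s\<close>. The square of this \<open>sinh\<close> is a quotient that the
  hyperboloid calculation can evaluate.\<close>

lemma hyp_dist_arsinh:
  assumes "x \<in> ball 0 1" "y \<in> ball 0 1"
  shows "hyp_dist x y = 2 * arsinh (sqrt ((cmod (x - y))\<^sup>2 / ((1 - (cmod x)\<^sup>2) * (1 - (cmod y)\<^sup>2))))"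
proof -
  define n s where "n = cmod (x - y)" and "s = (1 - (cmod x)\<^sup>2) * (1 - (cmod y)\<^sup>2)"
  have s: "s > 0" using assms by (simp add: s_def abs_square_less_1)
  have n: "n \<ge> 0" by (simp add: n_def)
  have r: "sqrt (n\<^sup>2 / s + 1) = sqrt (n\<^sup>2 + s) / sqrt s"
    using s by (simp add: field_simps flip: real_sqrt_divide)
  have "tanh (hyp_dist x y / 2) = n / sqrt (n\<^sup>2 + s)"
    using tanh_half_hyp_dist[OF assms] by (simp add: n_def s_def)
  also have "\<dots> = tanh (arsinh (sqrt (n\<^sup>2 / s)))"
    using s n r by (simp add: tanh_def cosh_arsinh_real real_sqrt_divide power_divide)
  finally show ?thesis unfolding n_def s_def by simp
qed

text \<open>The point \<open>(s (1, a) + (1, b) / s) / \<bar>a - b\<bar>\<close> of the hyperboloid, projected to the disk.\<close>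

definition geodesic_point :: "complex \<Rightarrow> complex \<Rightarrow> real \<Rightarrow> complex" where
  "geodesic_point a b s = (s *\<^sub>R a + (1 / s) *\<^sub>R b) /\<^sub>R (s + 1 / s + cmod (a - b))"

text \<open>For \<open>h \<noteq> 0\<close> this lies on the circle with centre \<open>m / h\<close>, for \<open>h = 0\<close> on the line through \<open>0\<close>
  orthogonal to \<open>m\<close>.\<close>

definition geodesic_locus :: "complex \<Rightarrow> real \<Rightarrow> complex set" where
  "geodesic_locus m h = {z \<in> ball 0 1. h * (1 + (cmod z)\<^sup>2) = 2 * (m \<bullet> z)}"

section \<open>Norms and distances of parametrised points\<close>

lemma inner_unit_conv_dist:
  fixes a b :: complex
  assumes "cmod a = 1" "cmod b = 1" shows "a \<bullet> b = 1 - (cmod (a - b))\<^sup>2 / 2"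
  using assms by (simp add: power2_norm_eq_inner inner_diff inner_commute
      flip: dot_square_norm) (simp add: dot_square_norm diff_divide_distrib)

lemma geodesic_point_commute: "geodesic_point a b s = geodesic_point b a (1 / s)"
  by (simp add: geodesic_point_def norm_minus_commute add_ac)

lemma geodesic_point_mult:
  assumes "cmod m = 1" shows "geodesic_point (m * a) (m * b) s = m * geodesic_point a b s"
proof -
  have "cmod (m * a - m * b) = cmod (a - b)"
    using assms by (simp add: norm_mult flip: right_diff_distrib)
  then show ?thesis by (simp add: geodesic_point_def algebra_simps)
qed

text \<open>For unit vectors the numerator has squared norm \<open>S\<^sup>2 - l\<^sup>2\<close>, so
  the squared norm of the point is \<open>(S - l) / (S + l)\<close>. Thus \<open>S / l\<close> is
  the time coordinate on the hyperboloid.\<close>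

lemma norm_geodesic_point:
  assumes "cmod a = 1" "cmod b = 1" "a \<noteq> b" "s > 0"
  defines "S \<equiv> s + 1 / s" and "l \<equiv> cmod (a - b)"
  shows "1 + (cmod (geodesic_point a b s))\<^sup>2 = 2 * S / (S + l)"
    and "1 - (cmod (geodesic_point a b s))\<^sup>2 = 2 * l / (S + l)"
proof -
  have pos: "S > 0" "l > 0" using assms by (auto simp: add_pos_pos)
  have "(cmod (s *\<^sub>R a + (1 / s) *\<^sub>R b))\<^sup>2 = s\<^sup>2 + 1 / s\<^sup>2 + 2 * (a \<bullet> b)"
    using assms(1,2,4) unfolding power2_norm_eq_inner
    by (simp add: inner_add inner_commute algebra_simps power2_eq_square)
      (simp add: dot_square_norm)
  also have "\<dots> = S\<^sup>2 - l\<^sup>2"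
  proof -
    have "S\<^sup>2 = s\<^sup>2 + 1 / s\<^sup>2 + 2"
      using assms(4) by (simp add: S_def power2_sum power_divide)
    moreover have "2 * (a \<bullet> b) = 2 - l\<^sup>2"
      using inner_unit_conv_dist[OF assms(1,2)] by (simp add: l_def)
    ultimately show ?thesis by simp
  qed
  finally have w: "(cmod (s *\<^sub>R a + (1 / s) *\<^sub>R b))\<^sup>2 = (S - l) * (S + l)"
    by (simp add: algebra_simps power2_eq_square)
  have "cmod (geodesic_point a b s) = cmod (s *\<^sub>R a + (1 / s) *\<^sub>R b) / (S + l)"
    using pos by (simp add: geodesic_point_def S_def l_def divide_inverse mult.commute)
  then have "(cmod (geodesic_point a b s))\<^sup>2 = (S - l) * (S + l) / (S + l)\<^sup>2"
    by (simp only: power_divide w)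
  also have "\<dots> = (S - l) / (S + l)" using pos by (simp add: power2_eq_square)
  finally have x: "(cmod (geodesic_point a b s))\<^sup>2 = (S - l) / (S + l)" .
  show "1 + (cmod (geodesic_point a b s))\<^sup>2 = 2 * S / (S + l)"
    "1 - (cmod (geodesic_point a b s))\<^sup>2 = 2 * l / (S + l)"
    using pos by (simp_all add: x field_simps)
qed

lemma geodesic_point_in_ball:
  assumes "cmod a = 1" "cmod b = 1" "a \<noteq> b" "s > 0"
  shows "geodesic_point a b s \<in> ball 0 1"
proof -
  have "0 < 2 * cmod (a - b) / (s + 1 / s + cmod (a - b))"
    using assms by (intro divide_pos_pos add_pos_nonneg) auto
  then have "(cmod (geodesic_point a b s))\<^sup>2 < 1"
    using norm_geodesic_point(2)[OF assms] by linarith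
  then show ?thesis by (simp add: abs_square_less_1)
qed

text \<open>The ratio on the left is \<open>sinh\<^sup>2 (\<rho> / 2)\<close>, so the left-hand side is \<open>cosh \<rho>\<close>; the right-hand side
  is \<open>- \<langle>X, Y\<rangle>\<close> for the points \<open>X\<close>, \<open>Y\<close> of the hyperboloid above \<open>x\<close>, \<open>y\<close>.\<close>

lemma geodesic_point_dist_ratio:
  assumes "cmod a = 1" "cmod b = 1" "a \<noteq> b" "cmod c = 1" "cmod d = 1" "c \<noteq> d" "s > 0" "u > 0"
  defines "x \<equiv> geodesic_point a b s" and "y \<equiv> geodesic_point c d u"
  shows "1 + 2 * ((cmod (x - y))\<^sup>2 / ((1 - (cmod x)\<^sup>2) * (1 - (cmod y)\<^sup>2))) =
    (s * u * (cmod (a - c))\<^sup>2 + (cmod (b - d))\<^sup>2 / (s * u)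
      + s / u * (cmod (a - d))\<^sup>2 + (cmod (b - c))\<^sup>2 / (s / u)) / (2 * (cmod (a - b) * cmod (c - d)))"
proof -
  define S T l k where "S = s + 1 / s" and "T = u + 1 / u" and "l = cmod (a - b)" and "k = cmod (c - d)"
  have pos: "l > 0" "k > 0" "S + l > 0" "T + k > 0"
    using assms by (auto simp: S_def T_def l_def k_def add_pos_pos add_pos_nonneg)
  note nx = norm_geodesic_point[OF assms(1-3,7), folded S_def l_def x_def]
  note ny = norm_geodesic_point[OF assms(4-6,8), folded T_def k_def y_def]
  define W where "W = (s *\<^sub>R a + (1 / s) *\<^sub>R b) \<bullet> (u *\<^sub>R c + (1 / u) *\<^sub>R d)"
  have xy: "x \<bullet> y = W / ((S + l) * (T + k))"
    by (simp add: x_def y_def geodesic_point_def W_def S_def T_def l_def k_def divide_inverse mult_ac)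
  define P Q where "P = 1 - (cmod x)\<^sup>2" and "Q = 1 - (cmod y)\<^sup>2"
  have PQ: "P = 2 * l / (S + l)" "Q = 2 * k / (T + k)" "P > 0" "Q > 0"
    using nx(2) ny(2) pos by (auto simp: P_def Q_def)
  have "P * Q + 2 * (cmod (x - y))\<^sup>2 = (1 + (cmod x)\<^sup>2) * (1 + (cmod y)\<^sup>2) - 4 * (x \<bullet> y)"
    by (simp add: P_def Q_def power2_norm_eq_inner inner_diff inner_commute algebra_simps)
  also have "\<dots> = 4 * (S * T - W) / ((S + l) * (T + k))"
    using pos by (simp add: nx(1) ny(1) xy diff_divide_distrib right_diff_distrib)
  finally have N: "P * Q + 2 * (cmod (x - y))\<^sup>2 = 4 * (S * T - W) / ((S + l) * (T + k))" .
  have "1 + 2 * ((cmod (x - y))\<^sup>2 / (P * Q)) = (P * Q + 2 * (cmod (x - y))\<^sup>2) / (P * Q)"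
    using PQ(3,4) by (simp add: add_divide_distrib)
  also have "\<dots> = (S * T - W) / (l * k)"
  proof -
    have "4 * Z / ((S + l) * (T + k)) / (P * Q) = Z / (l * k)" for Z
      using pos by (simp add: PQ(1,2))
    then show ?thesis unfolding N .
  qed
  \<comment> \<open>\<open>S * T\<close> and \<open>W\<close> carry the same four weights, so the
    difference has coefficients such as \<open>1 - a \<bullet> c\<close>, which is half a squared
    chord.\<close>
  also have "S * T - W = (s * u * (cmod (a - c))\<^sup>2 + (cmod (b - d))\<^sup>2 / (s * u)
      + s / u * (cmod (a - d))\<^sup>2 + (cmod (b - c))\<^sup>2 / (s / u)) / 2"
    using assms(7,8)
    by (simp add: W_def S_def T_def inner_add inner_unit_conv_dist assms(1,2,4,5) field_simps)
  finally show ?thesis by (simp add: P_def Q_def l_def k_def)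
qed

lemma arith_geo_mean_weighted:
  fixes p q t :: real
  assumes "t > 0" shows "2 * p * q \<le> t * p\<^sup>2 + q\<^sup>2 / t"
proof -
  have "0 \<le> (t * p - q)\<^sup>2 / t" using assms by simp
  also have "\<dots> = t * p\<^sup>2 + q\<^sup>2 / t - 2 * p * q"
    using assms by (simp add: field_simps power2_eq_square)
  finally show ?thesis by simp
qed

section \<open>The locus as a parametrised curve\<close>

text \<open>A rotation makes the chord vertical: \<open>m\<close> is a unit normal of the chord,
  \<open>h\<close> its signed distance from \<open>0\<close> and \<open>k\<close> half its
  length.\<close>

lemma unit_chordE:
  assumes "cmod a = 1" "cmod b = 1" "a \<noteq> b"
  obtains m h k where "cmod m = 1" "k > 0" "h\<^sup>2 + k\<^sup>2 = 1"
    "a = m * Complex h k" "b = m * Complex h (- k)"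
proof -
  obtain \<alpha> \<beta> where ab: "a = cis \<alpha>" "b = cis \<beta>"
    using assms by (metis complex_norm_eq_1_exp cis_conv_exp)
  define \<mu> \<theta> where "\<mu> = (\<alpha> + \<beta>) / 2" and "\<theta> = (\<alpha> - \<beta>) / 2"
  have "\<alpha> = \<mu> + \<theta>" "\<beta> = \<mu> + - \<theta>" by (auto simp: \<mu>_def \<theta>_def field_simps)
  then have e: "a = cis \<mu> * cis \<theta>" "b = cis \<mu> * cis (- \<theta>)"
    unfolding ab cis_mult by simp_all
  then have s: "sin \<theta> \<noteq> 0" using assms(3) by (auto simp: complex_eq_iff)
  show ?thesis
  proof (cases "sin \<theta> > 0")
    case True
    show ?thesis by (rule that[of "cis \<mu>" "sin \<theta>" "cos \<theta>"])
        (use True e in \<open>simp_all add: complex_eq_iff\<close>)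
  next
    case False
    \<comment> \<open>Changing the signs of \<open>m\<close>, \<open>h\<close> and \<open>k\<close>
      together keeps \<open>a\<close> and \<open>b\<close> and makes \<open>k\<close>
      positive.\<close>
    show ?thesis by (rule that[of "- cis \<mu>" "- sin \<theta>" "- cos \<theta>"])
        (use False s e in \<open>simp_all add: complex_eq_iff\<close>)
  qed
qed

lemma inner_mult_unit:
  assumes "cmod m = 1" shows "m \<bullet> (m * w) = Re w"
proof -
  have "m \<bullet> (m * w) = (Re m ^ 2 + Im m ^ 2) * Re w"
    by (simp add: inner_complex_def power2_eq_square algebra_simps)
  then show ?thesis using assms by (simp flip: cmod_power2)
qed

lemma geodesic_locus_rotate:
  assumes "cmod m = 1" shows "geodesic_locus m h = (*) m ` geodesic_locus 1 h"
proof -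
  have m: "m * cnj m = 1" using assms by (simp flip: complex_norm_square)
  have i: "m \<bullet> (m * w) = 1 \<bullet> w" for w
    by (simp only: inner_mult_unit[OF assms]) (simp add: inner_complex_def)
  have "m * w \<in> geodesic_locus m h \<longleftrightarrow> w \<in> geodesic_locus 1 h" for w
    using assms by (simp add: geodesic_locus_def norm_mult i)
  moreover have "z = m * (cnj m * z)" for z using m by (simp flip: mult.assoc)
  ultimately show ?thesis by (metis (no_types, lifting) image_iff subsetI subset_antisym)
qed

lemma geodesic_locus_1_eq:
  assumes hk: "h\<^sup>2 + k\<^sup>2 = 1" and k: "k > 0"
  shows "geodesic_locus 1 h = geodesic_point (Complex h k) (Complex h (- k)) ` {0<..}"
proof -
  define a b where "a = Complex h k" and "b = Complex h (- k)"
  have ab: "cmod a = 1" "cmod b = 1" "a \<noteq> b"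
    using hk k by (auto simp: a_def b_def cmod_def)
  have l: "cmod (a - b) = 2 * k"
    using k by (simp add: a_def b_def cmod_def real_sqrt_mult)
  have Re_gp: "Re (geodesic_point a b s) = h * (s + 1 / s) / (s + 1 / s + 2 * k)" for s
    by (simp add: geodesic_point_def l) (simp add: a_def b_def divide_inverse algebra_simps)
  have Im_gp: "Im (geodesic_point a b s) = k * (s - 1 / s) / (s + 1 / s + 2 * k)" for s
    by (simp add: geodesic_point_def l) (simp add: a_def b_def divide_inverse algebra_simps)
  have "geodesic_point a b s \<in> geodesic_locus 1 h" if "s > 0" for s
    using geodesic_point_in_ball[OF ab that] norm_geodesic_point(1)[OF ab that]
    by (simp add: geodesic_locus_def inner_complex_def Re_gp l)
  moreover have "z \<in> geodesic_point a b ` {0<..}" if z: "z \<in> geodesic_locus 1 h" for z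
  proof -
    define R D where "R = (cmod z)\<^sup>2" and "D = 1 - R"
    have x: "2 * Re z = h * (1 + R)" and D: "D > 0"
      using z by (auto simp: geodesic_locus_def inner_complex_def R_def D_def abs_square_less_1)
    have R: "R = (Re z)\<^sup>2 + (Im z)\<^sup>2" by (simp add: R_def cmod_power2)
    \<comment> \<open>Solving the equations \<open>S\<close> below for the parameter shows that it
      must be \<open>p / D\<close>, with reciprocal \<open>q / D\<close>. These are reciprocal
      because \<open>p * q = D\<^sup>2\<close>, and positive because \<open>p + q > 0\<close> as
      well.\<close>
    define p q where "p = k * (1 + R) + 2 * Im z" and "q = k * (1 + R) - 2 * Im z"
    have "p * q = k\<^sup>2 * (1 + R)\<^sup>2 - 4 * (Im z)\<^sup>2"
      by (simp add: p_def q_def algebra_simps power2_eq_square)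
    also have "k\<^sup>2 = 1 - h\<^sup>2" using hk by simp
    also have "(1 - h\<^sup>2) * (1 + R)\<^sup>2 = (1 + R)\<^sup>2 - (2 * Re z)\<^sup>2"
      unfolding x by (simp add: algebra_simps power2_eq_square)
    finally have pq: "p * q = D\<^sup>2"
      by (simp add: R D_def algebra_simps power2_eq_square)
    have "0 < p * q" using D by (simp add: pq)
    moreover have "0 < p + q"
      using k by (simp add: p_def q_def R_def add_pos_nonneg)
    ultimately have p: "p > 0" by (auto simp: zero_less_mult_iff)
    define s where "s = p / D"
    have s: "s > 0" using p D by (simp add: s_def)
    have s': "1 / s = q / D"
      using p D pq by (simp add: s_def field_simps power2_eq_square)
    have S: "s + 1 / s = 2 * k * (1 + R) / D" "s - 1 / s = 4 * Im z / D"
      unfolding s' by (simp_all add: s_def p_def q_def add_divide_distrib[symmetric]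
          diff_divide_distrib[symmetric])
    have S': "s + 1 / s + 2 * k = 4 * k / D"
      unfolding S(1) using D by (simp add: D_def field_simps)
    have x': "Re z = h * (1 + R) / 2" using x by simp
    have "geodesic_point a b s = z"
      unfolding complex_eq_iff Re_gp Im_gp S' unfolding S x' using D k by (simp add: field_simps)
    then show ?thesis using s by auto
  qed
  ultimately show ?thesis unfolding a_def b_def by blast
qed

lemma geodesic_locus_eq:
  assumes "cmod m = 1" "k > 0" "h\<^sup>2 + k\<^sup>2 = 1" "a = m * Complex h k" "b = m * Complex h (- k)"
  shows "geodesic_locus m h = geodesic_point a b ` {0<..}"
  by (simp add: assms(4,5) geodesic_locus_rotate[OF assms(1)] geodesic_locus_1_eq[OF assms(3,2)]
      geodesic_point_mult[OF assms(1)] image_image)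

section \<open>End points of the locus\<close>

text \<open>Dividing numerator and denominator by \<open>s\<close> leaves an expression in
  \<open>1 / s\<close> that is continuous at \<open>0\<close>.\<close>

lemma geodesic_point_limit: "(geodesic_point a b \<longlongrightarrow> a) at_top"
proof -
  define l where "l = cmod (a - b)"
  have 0: "((\<lambda>s::real. 1 / s) \<longlongrightarrow> 0) at_top"
    by (intro tendsto_divide_0[OF tendsto_const] filterlim_at_top_imp_at_infinity filterlim_ident)
  then have "((\<lambda>s. (1 / (1 + (1 / s) * (1 / s) + l * (1 / s))) *\<^sub>R
      (a + (1 / s * (1 / s)) *\<^sub>R b)) \<longlongrightarrow> (1 / (1 + 0 * 0 + l * 0)) *\<^sub>R (a + (0 * 0) *\<^sub>R b)) at_top"
    by (intro tendsto_intros) simp_all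
  moreover have "\<forall>\<^sub>F s in at_top. (1 / (1 + (1 / s) * (1 / s) + l * (1 / s))) *\<^sub>R
      (a + (1 / s * (1 / s)) *\<^sub>R b) = geodesic_point a b s"
    using eventually_gt_at_top[of "0::real"]
  proof eventually_elim
    case (elim s)
    have 1: "1 / (1 + (1 / s) * (1 / s) + l * (1 / s)) = s / (s + 1 / s + l)"
      using elim by (simp add: l_def field_simps)
    show ?case
      unfolding 1 using elim
      by (simp add: geodesic_point_def l_def scaleR_add_right divide_inverse mult.commute)
  qed
  ultimately show ?thesis by (simp add: tendsto_cong)
qed

text \<open>The defining equation is closed; on the unit circle it says
  \<open>m \<bullet> z = h\<close>, which only \<open>a\<close> and \<open>b\<close> satisfy. Both
  are limits of the parametrisation, \<open>b\<close> after exchanging the end points.\<close>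

lemma geodesic_locus_endpoints:
  assumes m: "cmod m = 1" and k: "k > 0" and hk: "h\<^sup>2 + k\<^sup>2 = 1"
    and a: "a = m * Complex h k" and b: "b = m * Complex h (- k)"
  shows "hyp_endpoints (geodesic_locus m h) = {a, b}"
proof (intro equalityI subsetI)
  fix z assume "z \<in> hyp_endpoints (geodesic_locus m h)"
  then have z: "z \<in> closure (geodesic_locus m h)" "cmod z = 1" by (auto simp: hyp_endpoints_def)
  have "closed {z. h * (1 + (cmod z)\<^sup>2) = 2 * (m \<bullet> z)}"
    by (intro closed_Collect_eq continuous_intros)
  then have "closure (geodesic_locus m h) \<subseteq> {z. h * (1 + (cmod z)\<^sup>2) = 2 * (m \<bullet> z)}"
    by (intro closure_minimal) (auto simp: geodesic_locus_def)
  with z have mz: "m \<bullet> z = h" by auto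
  have mm: "m * cnj m = 1" using m by (simp flip: complex_norm_square)
  define w where "w = cnj m * z"
  have zw: "z = m * w" using mm by (simp add: w_def flip: mult.assoc)
  have Re: "Re w = h" using mz by (simp add: w_def inner_complex_def)
  have "cmod w = 1" using z(2) m by (simp add: w_def norm_mult)
  then have "(Re w)\<^sup>2 + (Im w)\<^sup>2 = 1" by (simp flip: cmod_power2)
  then have "(Im w)\<^sup>2 = k\<^sup>2" using Re hk by simp
  then have "Im w = k \<or> Im w = - k" by (simp add: power2_eq_iff)
  then have "w = Complex h k \<or> w = Complex h (- k)" using Re by (auto simp: complex_eq_iff)
  then show "z \<in> {a, b}" by (auto simp: zw a b)
next
  have L: "geodesic_locus m h = geodesic_point a b ` {0<..}"
    by (rule geodesic_locus_eq[OF assms])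
  have L': "geodesic_point b a s \<in> geodesic_locus m h" if "s > 0" for s
    using that by (subst geodesic_point_commute) (simp add: L)
  have ev: "\<forall>\<^sub>F s in at_top. s > (0::real)" by (rule eventually_gt_at_top)
  have "a \<in> closure (geodesic_locus m h)"
    by (rule Lim_in_closed_set[OF closed_closure _ _ geodesic_point_limit[of a b]])
       (auto intro: eventually_mono[OF ev] closure_subset[THEN subsetD] simp: L)
  moreover have "b \<in> closure (geodesic_locus m h)"
    by (rule Lim_in_closed_set[OF closed_closure _ _ geodesic_point_limit[of b a]])
       (auto intro: eventually_mono[OF ev] closure_subset[THEN subsetD] L')
  moreover have "cmod a = 1" "cmod b = 1"
    using hk m by (simp_all add: a b norm_mult complex_norm)
  moreover fix z assume "z \<in> {a, b}"
  ultimately show "z \<in> hyp_endpoints (geodesic_locus m h)" by (auto simp: hyp_endpoints_def)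
qed

section \<open>Orthogonal circles and diameters\<close>

text \<open>The assumption on \<open>p\<close> is Pythagoras for radii meeting at a right angle; it
  removes \<open>r\<close> from the equation \<open>(dist p z)\<^sup>2 = r\<^sup>2\<close>.\<close>

lemma sphere_orthogonal_eq:
  fixes p :: complex
  assumes "r > 0" "(cmod p)\<^sup>2 = 1 + r\<^sup>2"
  shows "sphere p r = {z. 1 + (cmod z)\<^sup>2 = 2 * (p \<bullet> z)}"
proof -
  have "dist p z = r \<longleftrightarrow> 1 + (cmod z)\<^sup>2 = 2 * (p \<bullet> z)" for z
  proof -
    have "dist p z = r \<longleftrightarrow> (dist p z)\<^sup>2 = r\<^sup>2" using assms(1) by (simp add: power2_eq_iff_nonneg)
    also have "(dist p z)\<^sup>2 = (cmod p)\<^sup>2 + (cmod z)\<^sup>2 - 2 * (p \<bullet> z)"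
      unfolding dist_norm power2_norm_eq_inner by (simp add: inner_diff inner_commute)
    finally show ?thesis unfolding assms(2) by auto
  qed
  then show ?thesis unfolding sphere_def by (rule Collect_cong)
qed

text \<open>At a common point \<open>w\<close> orthogonality gives \<open>p \<bullet> w = 1\<close>,
  hence \<open>(cmod p)\<^sup>2 = 1 + r\<^sup>2\<close>.\<close>

lemma perp_unit_circle_imp:
  assumes "perp_unit_circle p r"
  shows "sphere p r = {z. 1 + (cmod z)\<^sup>2 = 2 * (p \<bullet> z)}"
proof -
  obtain w where w: "dist p w = r" "cmod w = 1" "(w - p) \<bullet> w = 0" and r: "r > 0"
    using assms by (fastforce simp: perp_unit_circle_def orthogonal_def)
  have "p \<bullet> w = 1" using w(2,3) by (simp add: inner_diff dot_square_norm)
  moreover have "r\<^sup>2 = (cmod p)\<^sup>2 + (cmod w)\<^sup>2 - 2 * (p \<bullet> w)"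
    unfolding w(1)[symmetric] dist_norm power2_norm_eq_inner by (simp add: inner_diff inner_commute)
  ultimately show ?thesis using r w(2) by (intro sphere_orthogonal_eq) simp_all
qed

lemma inner_eq_0_span:
  fixes m u :: complex
  assumes "m \<noteq> 0" "u \<noteq> 0" "m \<bullet> u = 0" shows "span {u} = {z. m \<bullet> z = 0}"
proof -
  have "z \<in> span {u}" if "m \<bullet> z = 0" for z
  proof -
    have "z = ((u \<bullet> z) / (u \<bullet> u)) *\<^sub>R u"
    proof -
      \<comment> \<open>Two vectors orthogonal to \<open>m\<close> have zero determinant, and the
        coordinates of \<open>w\<close> are multiples of that determinant.\<close>
      define w where "w = (u \<bullet> u) *\<^sub>R z - (u \<bullet> z) *\<^sub>R u"
      have "Re m * Re u + Im m * Im u = 0" "Re m * Re z + Im m * Im z = 0"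
        using assms(3) that by (simp_all add: inner_complex_def)
      then have "Re m * (Re u * Im z - Im u * Re z) = 0" "Im m * (Re u * Im z - Im u * Re z) = 0"
        by algebra+
      then have d: "Re u * Im z = Im u * Re z" using assms(1) by (auto simp: complex_eq_iff)
      have "Re w = Im u * (Im u * Re z - Re u * Im z)" "Im w = Re u * (Re u * Im z - Im u * Re z)"
        by (simp_all add: w_def inner_complex_def algebra_simps)
      then have "w = 0" using d by (simp add: complex_eq_iff)
      then have "(1 / (u \<bullet> u)) *\<^sub>R ((u \<bullet> u) *\<^sub>R z) = (1 / (u \<bullet> u)) *\<^sub>R ((u \<bullet> z) *\<^sub>R u)"
        by (simp add: w_def)
      then show ?thesis using assms(2) by simp
    qed
    then show ?thesis by (metis span_base span_scale singletonI)
  qed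
  moreover have "m \<bullet> z = 0" if "z \<in> span {u}" for z
    using that assms(3) by (auto simp: span_singleton)
  ultimately show ?thesis by blast
qed

lemma hyp_line_geodesic_locus:
  assumes m: "cmod m = 1" and k: "k > 0" and hk: "h\<^sup>2 + k\<^sup>2 = 1"
  shows "hyp_line (geodesic_locus m h)"
proof (cases "h = 0")
  case True
  have "m \<bullet> (\<i> * m) = 0" by (simp add: inner_complex_def)
  then have "span {\<i> * m} = {z. m \<bullet> z = 0}"
    using m by (intro inner_eq_0_span) auto
  then have "geodesic_locus m h = span {\<i> * m} \<inter> ball 0 1"
    by (auto simp: geodesic_locus_def True)
  moreover have "\<i> * m \<noteq> 0" using m by auto
  ultimately show ?thesis unfolding hyp_line_def by blast
next
  case False
  \<comment> \<open>The radius is forced by \<open>1 / h\<^sup>2 = 1 + (k / h)\<^sup>2\<close>, the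
    condition for orthogonality to the unit circle.\<close>
  define p r where "p = (1 / h) *\<^sub>R m" and "r = k / \<bar>h\<bar>"
  have r: "r > 0" using k False by (simp add: r_def)
  have pr: "(cmod p)\<^sup>2 = 1 + r\<^sup>2"
    using m hk False by (simp add: p_def r_def power_divide field_simps)
  note S = sphere_orthogonal_eq[OF r pr]
  have pz: "p \<bullet> z = (m \<bullet> z) / h" for z by (simp add: p_def)
  have "perp_unit_circle p r"
    unfolding perp_unit_circle_def
  proof (intro conjI ballI)
    have "p \<bullet> (m * Complex h k) = 1" using False by (simp add: pz inner_mult_unit[OF m])
    moreover have "cmod (m * Complex h k) = 1" using m hk by (simp add: norm_mult complex_norm)
    ultimately have "m * Complex h k \<in> sphere p r \<inter> sphere 0 1" by (simp add: S)
    then show "sphere p r \<inter> sphere 0 1 \<noteq> {}" by blast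
  next
    fix z assume "z \<in> sphere p r \<inter> sphere 0 1"
    then have "p \<bullet> z = 1" "cmod z = 1" by (auto simp: S)
    then show "orthogonal (z - p) z" by (simp add: orthogonal_def inner_diff dot_square_norm)
  qed (rule r)
  moreover have "geodesic_locus m h = sphere p r \<inter> ball 0 1"
    unfolding S using False by (auto simp: geodesic_locus_def pz field_simps)
  ultimately show ?thesis unfolding hyp_line_def by blast
qed

text \<open>This is the uniqueness behind \<open>geodesic_J\<close>. The circle or Euclidean line
  carrying \<open>L\<close> is closed, so it contains both end points, and these determine
  it.\<close>

lemma hyp_line_eq_geodesic_locus:
  assumes m: "cmod m = 1" and k: "k > 0" and hk: "h\<^sup>2 + k\<^sup>2 = 1"
    and L: "hyp_line L" and E: "hyp_endpoints L = {m * Complex h k, m * Complex h (- k)}"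
  shows "L = geodesic_locus m h"
proof -
  define a b where "a = m * Complex h k" and "b = m * Complex h (- k)"
  have ab: "cmod a = 1" "cmod b = 1" "a \<noteq> b"
    using hk m k by (auto simp: a_def b_def norm_mult complex_norm)
  have h: "m \<bullet> a = h" "m \<bullet> b = h" by (simp_all add: a_def b_def inner_mult_unit[OF m])
  have C: "a \<in> C" "b \<in> C" if "L = C \<inter> ball 0 1" "closed C" for C
  proof -
    have "closure L \<subseteq> C" using that by (intro closure_minimal) auto
    then show "a \<in> C" "b \<in> C" using E by (auto simp: hyp_endpoints_def a_def b_def)
  qed
  from L consider (circle) p r where "perp_unit_circle p r" "L = sphere p r \<inter> ball 0 1"
    | (line) u where "u \<noteq> 0" "L = span {u} \<inter> ball 0 1"
    unfolding hyp_line_def by blast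
  then show ?thesis
  proof cases
    case circle
    note S = perp_unit_circle_imp[OF circle(1)]
    have "p \<bullet> a = 1" "p \<bullet> b = 1" using C[OF circle(2) closed_sphere] ab by (auto simp: S)
    \<comment> \<open>With the rotation undone, \<open>p \<bullet> a = 1\<close> and
      \<open>p \<bullet> b = 1\<close> are two linear equations for the coordinates of
      \<open>q\<close>, with solution \<open>q = 1 / h\<close>.\<close>
    define q where "q = cnj m * p"
    have mm: "m * cnj m = 1" using m by (simp flip: complex_norm_square)
    have "p = m * q" using mm by (simp add: q_def flip: mult.assoc)
    have q: "Re q * h + Im q * k = 1" "Re q * h - Im q * k = 1"
      using \<open>p \<bullet> a = 1\<close> \<open>p \<bullet> b = 1\<close>
      by (simp_all add: a_def b_def q_def inner_complex_def algebra_simps)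
    then have "Im q * k = 0" by linarith
    then have Im: "Im q = 0" using k by simp
    with q have Re: "Re q * h = 1" by simp
    then have [simp]: "h \<noteq> 0" by auto
    have "q = of_real (1 / h)" using Im Re by (simp add: complex_eq_iff field_simps)
    then have p: "p = (1 / h) *\<^sub>R m" using \<open>p = m * q\<close> by (simp add: scaleR_conv_of_real)
    show ?thesis
      unfolding circle(2) S by (auto simp: geodesic_locus_def p field_simps)
  next
    case line
    obtain \<alpha> \<beta> where u: "a = \<alpha> *\<^sub>R u" "b = \<beta> *\<^sub>R u"
      using C[OF line(2) closed_subspace[OF subspace_span]] by (auto simp: span_singleton)
    \<comment> \<open>Both end points have inner product \<open>h\<close> with \<open>m\<close>;
      being distinct multiples of \<open>u\<close>, they force
      \<open>m \<bullet> u = 0\<close>.\<close>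
    then have "\<alpha> * (m \<bullet> u) = \<beta> * (m \<bullet> u)" "\<alpha> \<noteq> \<beta>" using h ab(3) by auto
    then have "m \<bullet> u = 0" by simp
    then have "span {u} = {z. m \<bullet> z = 0}"
      using m line(1) by (intro inner_eq_0_span) auto
    moreover have "h = 0" using h(1) u(1) \<open>m \<bullet> u = 0\<close> by simp
    ultimately show ?thesis unfolding line(2) by (auto simp: geodesic_locus_def)
  qed
qed

lemma geodesic_J_eq:
  assumes "cmod a = 1" "cmod b = 1" "a \<noteq> b"
  shows "geodesic_J a b = geodesic_point a b ` {0<..}"
proof -
  obtain m h k where c: "cmod m = 1" "k > 0" "h\<^sup>2 + k\<^sup>2 = 1"
    "a = m * Complex h k" "b = m * Complex h (- k)"
    using unit_chordE[OF assms] by blast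
  have "geodesic_J a b = geodesic_locus m h"
    unfolding geodesic_J_def
  proof (rule the_equality)
    show "hyp_line (geodesic_locus m h) \<and> hyp_endpoints (geodesic_locus m h) = {a, b}"
      using hyp_line_geodesic_locus[OF c(1-3)] geodesic_locus_endpoints[OF c] ..
    show "L = geodesic_locus m h" if "hyp_line L \<and> hyp_endpoints L = {a, b}" for L
      using that unfolding c(4,5) by (intro hyp_line_eq_geodesic_locus[OF c(1-3)]) simp_all
  qed
  then show ?thesis using geodesic_locus_eq[OF c] by simp
qed

subsection \<open>The distance of two geodesics\<close>

text \<open>\<open>F\<close> and \<open>G s u\<close> are values of \<open>cosh\<close>. The
  half-angle formula turns them into distances through the increasing map from \<open>x\<close> to
  \<open>2 * arsinh (sqrt ((x - 1) / 2))\<close>, so it is enough to minimise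
  \<open>G\<close>.\<close>

lemma hyp_setdist_geodesic_J:
  assumes a: "cmod a = 1" and b: "cmod b = 1" and c: "cmod c = 1" and d: "cmod d = 1"
    and ne: "distinct [a, b, c, d]"
  defines "F \<equiv> (cmod (a - c) * cmod (b - d) + cmod (a - d) * cmod (b - c)) / (cmod (a - b) * cmod (c - d))"
  shows "hyp_setdist (geodesic_J a b) (geodesic_J c d) = 2 * arsinh (sqrt ((F - 1) / 2))"
proof -
  define G where "G s u = (s * u * (cmod (a - c))\<^sup>2 + (cmod (b - d))\<^sup>2 / (s * u)
      + s / u * (cmod (a - d))\<^sup>2 + (cmod (b - c))\<^sup>2 / (s / u)) / (2 * (cmod (a - b) * cmod (c - d)))"
    for s u
  have ab: "a \<noteq> b" and cd: "c \<noteq> d" using ne by auto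
  have hd: "hyp_dist (geodesic_point a b s) (geodesic_point c d u) = 2 * arsinh (sqrt ((G s u - 1) / 2))"
    if "s > 0" "u > 0" for s u
    unfolding G_def geodesic_point_dist_ratio[OF a b ab c d cd that, symmetric]
      hyp_dist_arsinh[OF geodesic_point_in_ball[OF a b ab that(1)]
        geodesic_point_in_ball[OF c d cd that(2)]] by simp
  have F_le: "F \<le> G s u" if "s > 0" "u > 0" for s u
  proof -
    have "F = 2 * (cmod (a - c) * cmod (b - d) + cmod (a - d) * cmod (b - c))
        / (2 * (cmod (a - b) * cmod (c - d)))"
      by (simp add: F_def del: distrib_left_numeral)
    also have "\<dots> \<le> G s u"
      unfolding G_def
      using that arith_geo_mean_weighted[of "s * u" "cmod (a - c)" "cmod (b - d)"]
        arith_geo_mean_weighted[of "s / u" "cmod (a - d)" "cmod (b - c)"]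
      by (intro divide_right_mono) auto
    finally show ?thesis .
  qed
  \<comment> \<open>The two weighted means attain equality at \<open>s * u = P\<close> and at
    \<open>s / u = Q\<close>; these values can be prescribed together.\<close>
  define P Q where "P = cmod (b - d) / cmod (a - c)" and "Q = cmod (b - c) / cmod (a - d)"
  have PQ: "P > 0" "Q > 0" using ne by (auto simp: P_def Q_def)
  define s u where "s = sqrt (P * Q)" and "u = sqrt (P / Q)"
  have su: "s > 0" "u > 0" "s * u = P" "s / u = Q"
    using PQ by (simp_all add: s_def u_def flip: real_sqrt_mult real_sqrt_divide)
  have "G s u = 2 * (cmod (a - c) * cmod (b - d) + cmod (a - d) * cmod (b - c))
        / (2 * (cmod (a - b) * cmod (c - d)))"
    unfolding G_def su(3,4) using ne by (simp add: P_def Q_def power2_eq_square)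
  then have eq: "G s u = F" by (simp add: F_def del: distrib_left_numeral)
  show ?thesis
    unfolding hyp_setdist_def
  proof (rule cInf_eq_minimum)
    show "2 * arsinh (sqrt ((F - 1) / 2)) \<in>
        {hyp_dist x y |x y. x \<in> geodesic_J a b \<and> y \<in> geodesic_J c d}"
      using hd[OF su(1,2)] su(1,2) unfolding eq geodesic_J_eq[OF a b ab] geodesic_J_eq[OF c d cd]
      by (intro CollectI exI[of _ "geodesic_point a b s"] exI[of _ "geodesic_point c d u"]) simp
  next
    fix t assume "t \<in> {hyp_dist x y |x y. x \<in> geodesic_J a b \<and> y \<in> geodesic_J c d}"
    then obtain s u where "s > 0" "u > 0" "t = 2 * arsinh (sqrt ((G s u - 1) / 2))"
      unfolding geodesic_J_eq[OF a b ab] geodesic_J_eq[OF c d cd] by (auto simp: hd)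
    then show "2 * arsinh (sqrt ((F - 1) / 2)) \<le> t"
      using F_le[of s u] by (simp add: not_less[symmetric])
  qed
qed

subsection \<open>Ideal quadrilaterals\<close>

lemma cmod_cis_diff:
  assumes "\<alpha> \<le> \<beta>" "\<beta> \<le> \<alpha> + 2 * pi"
  shows "cmod (cis \<alpha> - cis \<beta>) = 2 * sin ((\<beta> - \<alpha>) / 2)"
proof -
  have s: "sin ((\<beta> - \<alpha>) / 2) \<ge> 0" using assms by (intro sin_ge_zero) auto
  have "(cmod (cis \<alpha> - cis \<beta>))\<^sup>2 = (2 * sin ((\<beta> - \<alpha>) / 2))\<^sup>2"
  proof -
    have "(cmod (cis \<alpha> - cis \<beta>))\<^sup>2 = 2 - 2 * cos (\<beta> - \<alpha>)"
      using sin_cos_squared_add[of \<alpha>] sin_cos_squared_add[of \<beta>]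
      unfolding cmod_power2 by (simp add: cos_diff power2_eq_square algebra_simps)
    also have "cos (\<beta> - \<alpha>) = 1 - 2 * (sin ((\<beta> - \<alpha>) / 2))\<^sup>2"
      using cos_double_sin[of "(\<beta> - \<alpha>) / 2"] by (simp del: right_diff_distrib_numeral)
    finally show ?thesis by (simp add: power_mult_distrib)
  qed
  then show ?thesis by (rule power2_eq_imp_eq) (use s in simp_all)
qed

text \<open>Chords are twice the sines of half arcs, and the order of the vertices keeps all these
  sines positive.\<close>

lemma ideal_quadrilateral_ptolemy:
  assumes "ideal_quadrilateral a b c d"
  shows "cmod (a - c) * cmod (b - d) = cmod (a - b) * cmod (c - d) + cmod (b - c) * cmod (a - d)"
proof -
  obtain \<alpha> \<beta> \<gamma> \<delta> where e: "a = cis \<alpha>" "b = cis \<beta>" "c = cis \<gamma>" "d = cis \<delta>"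
     "\<alpha> < \<beta>" "\<beta> < \<gamma>" "\<gamma> < \<delta>" "\<delta> < \<alpha> + 2 * pi"
    using assms unfolding ideal_quadrilateral_def by blast
  \<comment> \<open>After expansion this is the Pluecker relation for the 2 by 2 determinants of the
    four vectors \<open>(cos, sin)\<close> at the half angles.\<close>
  have "sin ((\<gamma> - \<alpha>) / 2) * sin ((\<delta> - \<beta>) / 2) =
    sin ((\<beta> - \<alpha>) / 2) * sin ((\<delta> - \<gamma>) / 2) + sin ((\<gamma> - \<beta>) / 2) * sin ((\<delta> - \<alpha>) / 2)"
    unfolding diff_divide_distrib sin_diff by algebra
  then show ?thesis
    unfolding e(1-4) using e(5-8) by (simp add: cmod_cis_diff)
qed

lemma ideal_quadrilateral_distinct:
  assumes "ideal_quadrilateral a b c d"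
  shows "distinct [a, b, c, d]"
proof -
  obtain \<alpha> \<beta> \<gamma> \<delta> where e: "a = cis \<alpha>" "b = cis \<beta>" "c = cis \<gamma>" "d = cis \<delta>"
     "\<alpha> < \<beta>" "\<beta> < \<gamma>" "\<gamma> < \<delta>" "\<delta> < \<alpha> + 2 * pi"
    using assms unfolding ideal_quadrilateral_def by blast
  have "cis x \<noteq> cis y" if "x < y" "y < x + 2 * pi" for x y
  proof -
    have "cmod (cis x - cis y) > 0" using that by (subst cmod_cis_diff) (auto intro!: sin_gt_zero)
    then show ?thesis by auto
  qed
  then show ?thesis using e by auto
qed

lemma ideal_quadrilateral_unit:
  assumes "ideal_quadrilateral a b c d"
  shows "cmod a = 1" "cmod b = 1" "cmod c = 1" "cmod d = 1"
  using assms by (auto simp: ideal_quadrilateral_def)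

theorem corollary1p4:
  fixes a b c d :: complex and d1 d2 :: real
  assumes quad: "ideal_quadrilateral a b c d"
    and d1: "d1 = hyp_setdist (geodesic_J a d) (geodesic_J b c)"
    and d2: "d2 = hyp_setdist (geodesic_J a b) (geodesic_J c d)"
  shows "d1 * d2 \<le> (2 * ln (sqrt 2 + 1))\<^sup>2
    \<and> d1 + d2 \<ge> 4 * ln (sqrt 2 + 1)
    \<and> (d1 * d2 = (2 * ln (sqrt 2 + 1))\<^sup>2 \<longleftrightarrow> absolute_ratio a b c d = 2)
    \<and> (d1 + d2 = 4 * ln (sqrt 2 + 1) \<longleftrightarrow> absolute_ratio a b c d = 2)"
proof -
  note unit = ideal_quadrilateral_unit[OF quad]
  note ne = ideal_quadrilateral_distinct[OF quad]
  \<comment> \<open>These are the products of opposite sides. By Ptolemy the diagonals contribute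
    \<open>p + q\<close>, so everything depends on \<open>p / q\<close>.\<close>
  define p q where "p = cmod (a - b) * cmod (c - d)" and "q = cmod (b - c) * cmod (a - d)"
  have pq: "p > 0" "q > 0" using ne by (auto simp: p_def q_def)
  have ptolemy: "cmod (a - c) * cmod (b - d) = p + q"
    using ideal_quadrilateral_ptolemy[OF quad] by (simp add: p_def q_def)
  define v where "v = sqrt (p / q)"
  have v: "v > 0" "1 / v = sqrt (q / p)" using pq by (simp_all add: v_def real_sqrt_divide)
  have "hyp_setdist (geodesic_J a d) (geodesic_J b c) = 2 * arsinh (sqrt (((p + (p + q)) / q - 1) / 2))"
  proof -
    \<comment> \<open>The order \<open>a, d, b, c\<close> pairs the side from \<open>a\<close> to
      \<open>d\<close> with that from \<open>b\<close> to \<open>c\<close>; the numerator consists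
      of \<open>p\<close> and the diagonals.\<close>
    have F: "(cmod (a - b) * cmod (d - c) + cmod (a - c) * cmod (d - b)) / (cmod (a - d) * cmod (b - c))
        = (p + (p + q)) / q"
      unfolding norm_minus_commute[of d] ptolemy by (simp add: p_def q_def mult.commute)
    have "distinct [a, d, b, c]" using ne by auto
    from hyp_setdist_geodesic_J[OF unit(1,4,2,3) this, unfolded F] show ?thesis .
  qed
  also have "((p + (p + q)) / q - 1) / 2 = p / q" using pq by (simp add: field_simps)
  finally have d1': "d1 = 2 * arsinh v" by (simp add: d1 v_def)
  have "hyp_setdist (geodesic_J a b) (geodesic_J c d) = 2 * arsinh (sqrt (((p + q + q) / p - 1) / 2))"
    using ne hyp_setdist_geodesic_J[of a b c d] unit ptolemy
    by (simp add: p_def q_def mult.commute)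
  also have "((p + q + q) / p - 1) / 2 = q / p" using pq by (simp add: field_simps)
  finally have d2': "d2 = 2 * arsinh (1 / v)" by (simp add: d2 v)
  have "absolute_ratio a b c d = (p + q) / p"
    by (simp add: absolute_ratio_def ptolemy) (simp add: p_def)
  then have ratio: "absolute_ratio a b c d = 2 \<longleftrightarrow> v = 1"
    using pq by (auto simp: v_def field_simps)
  have L: "ln (sqrt 2 + 1) = arsinh (1::real)" by (simp add: arsinh_real_def add.commute)
  show ?thesis
  \<comment> \<open>At \<open>v = 1\<close> both bounds are attained; elsewhere both are strict,
    which settles the inequalities and the equality cases at once.\<close>
  proof (cases "v = 1")
    case True
    then show ?thesis unfolding ratio L d1' d2' by (simp add: power2_eq_square)
  next
    case False
    then show ?thesis
      using arsinh_mult_arsinh_inverse_less[OF v(1)] arsinh_add_arsinh_inverse_gt[OF v(1)]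
      unfolding ratio L d1' d2' by (simp add: power_mult_distrib)
  qed
qed

end
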